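(* Let $G$ be a group such that for every element $h\in G$ the twisted conjugacy class $[e]_h$ of the unit element is a subgroup of $G$. Then $G$ belongs to the Kurosh–Chernikov class $\overline{Z}$.
   Context: For $h\in G$, $[e]_h=\{z^{-1}h^{-1}zh\mid z\in G\}$ is the twisted conjugacy class of the unit element $e$ with respect to the inner automorphism $x\mapsto h^{-1}xh$. A group $G$ belongs to the Kurosh–Chernikov class $\overline{Z}$ if every series of $G$ can be refined to a central series. Here "series" is meant in the generalized sense of normal systems: a series is a set of normal subgroups of $G$, totally ordered by inclusion, containing $\{e\}$ and $G$ and closed under arbitrary unions and intersections; one series refines another if it contains it; and a series is central if for every jump $A<B$ in it (i.e. $A,B$ are members with no member strictly between them) one has $[B,G]\le A$. *)

theory Defs
  imports "HOL-Algebra.Algebra"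
begin

definition twisted_conj_class ::
    "('a, 'b) monoid_scheme \<Rightarrow> ('a \<Rightarrow> 'a) \<Rightarrow> 'a \<Rightarrow> 'a set"
  where "twisted_conj_class G \<phi> x =
    {inv\<^bsub>G\<^esub> z \<otimes>\<^bsub>G\<^esub> x \<otimes>\<^bsub>G\<^esub> \<phi> z | z. z \<in> carrier G}"

definition inner_aut :: "('a, 'b) monoid_scheme \<Rightarrow> 'a \<Rightarrow> 'a \<Rightarrow> 'a"
  where "inner_aut G h = (\<lambda>x. inv\<^bsub>G\<^esub> h \<otimes>\<^bsub>G\<^esub> x \<otimes>\<^bsub>G\<^esub> h)"

text \<open>The twisted class \<open>[e]\<^sub>h\<close> of the unit element.\<close>

definition unit_class :: "('a, 'b) monoid_scheme \<Rightarrow> 'a \<Rightarrow> 'a set"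
  where "unit_class G h = twisted_conj_class G (inner_aut G h) \<one>\<^bsub>G\<^esub>"

lemma (in group) unit_class_eq:
  assumes "h \<in> carrier G"
  shows "unit_class G h = {inv z \<otimes> inv h \<otimes> z \<otimes> h | z. z \<in> carrier G}"
proof -
  have "inv z \<otimes> \<one> \<otimes> (inv h \<otimes> z \<otimes> h) = inv z \<otimes> inv h \<otimes> z \<otimes> h"
    if "z \<in> carrier G" for z
    using that assms by (simp add: m_assoc)
  then show ?thesis
    unfolding unit_class_def twisted_conj_class_def inner_aut_def by (metis (no_types, lifting))
qed

text \<open>The mutual commutator subgroup \<open>[H, K]\<close>.\<close>

definition commutator_subgroup ::
    "('a, 'b) monoid_scheme \<Rightarrow> 'a set \<Rightarrow> 'a set \<Rightarrow> 'a set"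
  where "commutator_subgroup G H K = generate G
    {inv\<^bsub>G\<^esub> x \<otimes>\<^bsub>G\<^esub> inv\<^bsub>G\<^esub> y \<otimes>\<^bsub>G\<^esub> x \<otimes>\<^bsub>G\<^esub> y | x y. x \<in> H \<and> y \<in> K}"

text \<open>Closure under arbitrary unions and intersections refers to nonempty subfamilies:
  in HOL the empty union is the empty set and the empty intersection is the whole type,
  which in general are not subgroups of \<open>G\<close>.\<close>

definition group_series :: "('a, 'b) monoid_scheme \<Rightarrow> 'a set set \<Rightarrow> bool"
  where "group_series G S \<longleftrightarrow>
    (\<forall>N\<in>S. N \<lhd> G) \<and>
    chain\<^sub>\<subseteq> S \<and>
    {\<one>\<^bsub>G\<^esub>} \<in> S \<and> carrier G \<in> S \<and>
    (\<forall>F. F \<subseteq> S \<and> F \<noteq> {} \<longrightarrow> \<Union>F \<in> S \<and> \<Inter>F \<in> S)"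

definition series_jump :: "'a set set \<Rightarrow> 'a set \<Rightarrow> 'a set \<Rightarrow> bool"
  where "series_jump S A B \<longleftrightarrow>
    A \<in> S \<and> B \<in> S \<and> A \<subset> B \<and> \<not> (\<exists>C\<in>S. A \<subset> C \<and> C \<subset> B)"

definition central_series :: "('a, 'b) monoid_scheme \<Rightarrow> 'a set set \<Rightarrow> bool"
  where "central_series G S \<longleftrightarrow> group_series G S \<and>
    (\<forall>A B. series_jump S A B \<longrightarrow> commutator_subgroup G B (carrier G) \<subseteq> A)"

definition Kurosh_Chernikov_Zbar :: "('a, 'b) monoid_scheme \<Rightarrow> bool"
  where "Kurosh_Chernikov_Zbar G \<longleftrightarrow> group G \<and>
    (\<forall>S. group_series G S \<longrightarrow> (\<exists>T. S \<subseteq> T \<and> central_series G T))"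

end

theory Submission
  imports Defs
begin

text \<open>
  The unit class \<open>[e]\<^sub>h\<close> is the translate \<open>C h\<close> of the ordinary conjugacy class \<open>C\<close> of \<open>h\<^sup>-\<^sup>1\<close>. Conjugation
  fixes \<open>C\<close>, so it maps \<open>C h\<close> to another translate of \<open>C h\<close>. If \<open>C h\<close> is a subgroup, then
  its conjugates are therefore cosets of it that contain \<open>e\<close>; hence \<open>C h\<close> is normal
  (\<open>unit_class_normal\<close>).

  Let \<open>A < B\<close> be normal subgroups of \<open>G\<close> with no normal subgroup of \<open>G\<close> strictly between them, and
  let \<open>b \<in> B\<close>. The normal subgroup \<open>A [e]\<^sub>b\<close> lies between \<open>A\<close> and \<open>B\<close>. It can be \<open>B\<close> only if \<open>b\<close>
  lies in it; modulo \<open>A\<close> this says \<open>b = z\<^sup>-\<^sup>1 b\<^sup>-\<^sup>1 z b\<close>, so that a conjugate of \<open>b\<^sup>-\<^sup>1\<close> is trivial modulo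
  \<open>A\<close> and \<open>b \<in> A\<close>. For \<open>b \<notin> A\<close> it follows that \<open>A [e]\<^sub>b = A\<close>, that is, \<open>b\<close> is central modulo \<open>A\<close>
  (\<open>chief_factor_central\<close>).

  Zorn's lemma extends a given series to a chain of normal subgroups that is maximal. Maximality
  gives closure under unions and intersections, and it leaves no normal subgroup strictly inside
  a jump, so every jump of the maximal chain is central.
\<close>

section \<open>Unit classes that are subgroups\<close>

context group
begin

lemma inv_mult_cancel:
  assumes "x \<in> carrier G" "y \<in> carrier G"
  shows "inv x \<otimes> (x \<otimes> y) = y" "x \<otimes> (inv x \<otimes> y) = y"
  using assms by (simp_all flip: m_assoc)

text \<open>
  Put \<open>c z = z\<^sup>-\<^sup>1 h\<^sup>-\<^sup>1 z h\<close>. The identity \<open>g (c z) g\<^sup>-\<^sup>1 = c (z g\<^sup>-\<^sup>1) (c (g\<^sup>-\<^sup>1))\<^sup>-\<^sup>1\<close> expresses a conjugate of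
  an element of the class as a quotient of two elements of the class.
\<close>

lemma unit_class_normal:
  assumes h: "h \<in> carrier G" and sub: "subgroup (unit_class G h) G"
  shows "unit_class G h \<lhd> G"
proof (rule normal_invI[OF sub])
  fix g u
  assume g: "g \<in> carrier G" and "u \<in> unit_class G h"
  define c where "c z = inv z \<otimes> inv h \<otimes> z \<otimes> h" for z
  have c_mem: "c z \<in> unit_class G h" if "z \<in> carrier G" for z
    using that h by (auto simp: unit_class_eq c_def)
  obtain z where z: "z \<in> carrier G" and u: "u = c z"
    using \<open>u \<in> unit_class G h\<close> h by (auto simp: unit_class_eq c_def)
  have "g \<otimes> u \<otimes> inv g = c (z \<otimes> inv g) \<otimes> inv (c (inv g))"
    using g z h by (simp add: u c_def m_assoc inv_mult_group inv_mult_cancel)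
  moreover have "c (z \<otimes> inv g) \<in> unit_class G h" "c (inv g) \<in> unit_class G h"
    using g z by (simp_all add: c_mem)
  ultimately show "g \<otimes> u \<otimes> inv g \<in> unit_class G h"
    using sub by (simp add: subgroup.m_closed subgroup.m_inv_closed)
qed

lemma set_mult_normal:
  assumes "M \<lhd> G" "N \<lhd> G"
  shows "M <#> N \<lhd> G"
proof (rule normal_invI)
  show "subgroup (M <#> N) G"
    using assms by (simp add: mult_norm_subgroup normal_imp_subgroup)
next
  fix x u
  assume x: "x \<in> carrier G" and "u \<in> M <#> N"
  then obtain m n where mn: "m \<in> M" "n \<in> N" and u: "u = m \<otimes> n"
    by (auto simp: set_mult_def)
  have carr: "m \<in> carrier G" "n \<in> carrier G"
    using mn assms by (auto dest: normal_imp_subgroup subgroup.mem_carrier)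
  have "x \<otimes> u \<otimes> inv x = (x \<otimes> m \<otimes> inv x) \<otimes> (x \<otimes> n \<otimes> inv x)"
    using x carr by (simp add: u m_assoc inv_mult_cancel)
  then show "x \<otimes> u \<otimes> inv x \<in> M <#> N"
    using normal_invE(2)[OF assms(1) x mn(1)] normal_invE(2)[OF assms(2) x mn(2)]
    by (auto simp: set_mult_def)
qed

section \<open>Chief factors\<close>

lemma unit_class_subset_normal:
  assumes "N \<lhd> G" "b \<in> N"
  shows "unit_class G b \<subseteq> N"
proof
  fix u assume "u \<in> unit_class G b"
  have sub: "subgroup N G" and b: "b \<in> carrier G"
    using assms by (auto dest: normal_imp_subgroup subgroup.mem_carrier)
  then obtain z where z: "z \<in> carrier G" and u: "u = inv z \<otimes> inv b \<otimes> z \<otimes> b"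
    using \<open>u \<in> unit_class G b\<close> by (auto simp: unit_class_eq)
  have "inv z \<otimes> inv b \<otimes> z \<in> N"
    using normal.inv_op_closed1[OF assms(1) z] subgroup.m_inv_closed[OF sub assms(2)] by blast
  then show "u \<in> N"
    using u assms(2) subgroup.m_closed[OF sub] by blast
qed

text \<open>
  This excludes the alternative \<open>A [e]\<^sub>b = B\<close> for \<open>b \<in> B\<close> outside \<open>A\<close>. It is an ordinary cancellation:
  if \<open>b = a (z\<^sup>-\<^sup>1 b\<^sup>-\<^sup>1 z) b\<close> with \<open>a \<in> A\<close>, then \<open>a = z\<^sup>-\<^sup>1 b z\<close>, so that \<open>b\<close> is a conjugate of \<open>a\<close>.
\<close>

lemma mem_normal_if_mem_mult_unit_class:
  assumes A: "A \<lhd> G" and b: "b \<in> carrier G" and mem: "b \<in> A <#> unit_class G b"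
  shows "b \<in> A"
proof -
  obtain a z where a: "a \<in> A" and z: "z \<in> carrier G"
    and eq: "b = a \<otimes> (inv z \<otimes> inv b \<otimes> z \<otimes> b)"
    using mem b by (auto simp: set_mult_def unit_class_eq)
  have ac: "a \<in> carrier G"
    using a A by (auto dest: normal_imp_subgroup subgroup.mem_carrier)
  (* The factor \<one> makes both sides products ending in b, which right cancellation then removes. *)
  have "\<one> \<otimes> b = (a \<otimes> inv z \<otimes> inv b \<otimes> z) \<otimes> b"
    using eq ac z b by (simp add: m_assoc)
  then have "a \<otimes> inv z \<otimes> inv b \<otimes> z = \<one>"
    using ac z b by (metis r_cancel m_closed inv_closed one_closed)
  then have "z \<otimes> (a \<otimes> inv z \<otimes> inv b \<otimes> z) \<otimes> (inv z \<otimes> b) = b"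
    using z b by (simp add: inv_mult_cancel)
  then have "z \<otimes> a \<otimes> inv z = b"
    using ac z b by (simp add: m_assoc inv_mult_cancel)
  then show ?thesis
    using normal_invE(2)[OF A z a] by simp
qed

text \<open>
  The hypothesis on unit classes is used to make \<open>[e]\<^sub>b\<close> normal in \<open>G\<close>, so that the product \<open>A [e]\<^sub>b\<close> is one
  of the normal subgroups between \<open>A\<close> and \<open>B\<close>. The elements of \<open>[e]\<^sub>x\<close> are the inverses of the
  generators of \<open>[B, G]\<close> with first entry \<open>x\<close>, so it is enough to put every \<open>[e]\<^sub>x\<close>, \<open>x \<in> B\<close>, inside \<open>A\<close>.
\<close>

lemma chief_factor_central:
  assumes cls: "\<And>h. h \<in> carrier G \<Longrightarrow> subgroup (unit_class G h) G"
    and A: "A \<lhd> G" and B: "B \<lhd> G" and AB: "A \<subseteq> B"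
    and chief: "\<And>N. \<lbrakk>N \<lhd> G; A \<subseteq> N; N \<subseteq> B\<rbrakk> \<Longrightarrow> N = A \<or> N = B"
  shows "commutator_subgroup G B (carrier G) \<subseteq> A"
proof -
  have subA: "subgroup A G" and subB: "subgroup B G"
    using A B by (auto dest: normal_imp_subgroup)
  have unit_class_sub: "unit_class G b \<subseteq> A" if bB: "b \<in> B" for b
  proof (cases "b \<in> A")
    case True
    then show ?thesis by (rule unit_class_subset_normal[OF A])
  next
    case False
    let ?H = "unit_class G b"
    have b: "b \<in> carrier G"
      using bB subB by (rule subgroup.mem_carrier[rotated])
    have H: "?H \<lhd> G" and subH: "subgroup ?H G"
      using unit_class_normal cls b by blast+
    have A_le: "A \<subseteq> A <#> ?H"
    proof
      fix a assume "a \<in> A"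
      moreover have "a = a \<otimes> \<one>"
        using \<open>a \<in> A\<close> subA by (simp add: subgroup.mem_carrier)
      ultimately show "a \<in> A <#> ?H"
        using subgroup.one_closed[OF subH] by (auto simp: set_mult_def)
    qed
    have H_le: "?H \<subseteq> A <#> ?H"
    proof
      fix u assume "u \<in> ?H"
      moreover have "u = \<one> \<otimes> u"
        using \<open>u \<in> ?H\<close> subH by (simp add: subgroup.mem_carrier)
      ultimately show "u \<in> A <#> ?H"
        using subgroup.one_closed[OF subA] by (auto simp: set_mult_def)
    qed
    have le_B: "A <#> ?H \<subseteq> B"
      using AB unit_class_subset_normal[OF B bB] subgroup.m_closed[OF subB]
      by (auto simp: set_mult_def)
    have "A <#> ?H \<noteq> B"
      using mem_normal_if_mem_mult_unit_class[OF A b] bB False by blast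
    then have "A <#> ?H = A"
      using chief[OF set_mult_normal[OF A H] A_le le_B] by blast
    then show ?thesis using H_le by simp
  qed
  have "inv x \<otimes> inv y \<otimes> x \<otimes> y \<in> A" if x: "x \<in> B" and y: "y \<in> carrier G" for x y
  proof -
    have xc: "x \<in> carrier G"
      using x subB by (rule subgroup.mem_carrier[rotated])
    have "inv y \<otimes> inv x \<otimes> y \<otimes> x \<in> unit_class G x"
      using y xc by (auto simp: unit_class_eq)
    then have "inv (inv y \<otimes> inv x \<otimes> y \<otimes> x) \<in> A"
      using unit_class_sub[OF x] subgroup.m_inv_closed[OF subA] by blast
    then show ?thesis
      using xc y by (simp add: inv_mult_group m_assoc)
  qed
  then show ?thesis
    unfolding commutator_subgroup_def by (intro generate_subgroup_incl[OF _ subA]) blast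
qed

section \<open>Maximal chains of normal subgroups\<close>

lemma normal_Union_chain:
  assumes ne: "F \<noteq> {}" and ch: "chain\<^sub>\<subseteq> F" and norm: "\<And>N. N \<in> F \<Longrightarrow> N \<lhd> G"
  shows "\<Union>F \<lhd> G"
proof (rule normal_invI)
  have sub: "subgroup N G" if "N \<in> F" for N
    using norm[OF that] by (rule normal_imp_subgroup)
  show "subgroup (\<Union>F) G"
  proof (rule subgroupI)
    show "\<Union>F \<subseteq> carrier G" using sub subgroup.subset by blast
    show "\<Union>F \<noteq> {}" using ne sub subgroup.one_closed by blast
    show "inv a \<in> \<Union>F" if "a \<in> \<Union>F" for a
      using that subgroup.m_inv_closed[OF sub] by auto
    show "a \<otimes> b \<in> \<Union>F" if ab: "a \<in> \<Union>F" "b \<in> \<Union>F" for a b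
    proof -
      obtain M N where MN: "M \<in> F" "N \<in> F" "a \<in> M" "b \<in> N" using ab by blast
      then have "M \<subseteq> N \<or> N \<subseteq> M" using ch by (auto simp: chain_subset_def)
      then obtain K where "K \<in> F" "a \<in> K" "b \<in> K" using MN by blast
      then show ?thesis using subgroup.m_closed[OF sub] by auto
    qed
  qed
  show "x \<otimes> u \<otimes> inv x \<in> \<Union>F" if "x \<in> carrier G" "u \<in> \<Union>F" for x u
    using that normal_invE(2)[OF norm] by auto
qed

lemma normal_Inter:
  assumes ne: "F \<noteq> {}" and norm: "\<And>N. N \<in> F \<Longrightarrow> N \<lhd> G"
  shows "\<Inter>F \<lhd> G"
proof (rule normal_invI)
  show "subgroup (\<Inter>F) G"
    using norm normal_imp_subgroup ne by (intro subgroups_Inter) auto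
  show "x \<otimes> u \<otimes> inv x \<in> \<Inter>F" if "x \<in> carrier G" "u \<in> \<Inter>F" for x u
    using that normal_invE(2)[OF norm] by auto
qed

text \<open>
  Maximality is recorded as a closure property: a normal subgroup comparable with all members is
  itself a member.
\<close>

lemma normal_chain_extends_to_maximal:
  assumes norm: "\<forall>N\<in>S. N \<lhd> G" and ch: "chain\<^sub>\<subseteq> S"
  obtains T where "S \<subseteq> T" "\<forall>N\<in>T. N \<lhd> G" "chain\<^sub>\<subseteq> T"
    "\<And>N. \<lbrakk>N \<lhd> G; \<forall>M\<in>T. M \<subseteq> N \<or> N \<subseteq> M\<rbrakk> \<Longrightarrow> N \<in> T"
proof -
  define \<A> where "\<A> = {T. S \<subseteq> T \<and> (\<forall>N\<in>T. N \<lhd> G) \<and> chain\<^sub>\<subseteq> T}"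
  have "\<exists>T\<in>\<A>. \<forall>U\<in>\<A>. T \<subseteq> U \<longrightarrow> U = T"
  proof (rule subset_Zorn_nonempty)
    show "\<A> \<noteq> {}" using norm ch by (auto simp: \<A>_def)
    fix \<B> assume ne: "\<B> \<noteq> {}" and "subset.chain \<A> \<B>"
    then have sub: "\<B> \<subseteq> \<A>" and cmp: "\<And>U V. \<lbrakk>U \<in> \<B>; V \<in> \<B>\<rbrakk> \<Longrightarrow> U \<subseteq> V \<or> V \<subseteq> U"
      by (auto simp: subset_chain_def)
    have "chain\<^sub>\<subseteq> (\<Union>\<B>)"
      unfolding chain_subset_def
    proof (intro ballI)
      fix M N assume "M \<in> \<Union>\<B>" "N \<in> \<Union>\<B>"
      then obtain U where "U \<in> \<B>" "M \<in> U" "N \<in> U" using cmp by blast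
      moreover have "chain\<^sub>\<subseteq> U" using \<open>U \<in> \<B>\<close> sub by (auto simp: \<A>_def)
      ultimately show "M \<subseteq> N \<or> N \<subseteq> M" by (simp add: chain_subset_def)
    qed
    moreover have "S \<subseteq> \<Union>\<B>" using ne sub by (auto simp: \<A>_def)
    moreover have "\<forall>N\<in>\<Union>\<B>. N \<lhd> G" using sub by (auto simp: \<A>_def)
    ultimately show "\<Union>\<B> \<in> \<A>" by (simp add: \<A>_def)
  qed
  then obtain T where T: "T \<in> \<A>" and max: "\<And>U. \<lbrakk>U \<in> \<A>; T \<subseteq> U\<rbrakk> \<Longrightarrow> U = T" by blast
  show thesis
  proof
    show "S \<subseteq> T" "\<forall>N\<in>T. N \<lhd> G" "chain\<^sub>\<subseteq> T" using T by (auto simp: \<A>_def)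
    fix N assume "N \<lhd> G" "\<forall>M\<in>T. M \<subseteq> N \<or> N \<subseteq> M"
    then have "insert N T \<in> \<A>" using T by (auto simp: \<A>_def chain_subset_def)
    then have "insert N T = T" using max by blast
    then show "N \<in> T" by blast
  qed
qed

text \<open>
  A union or intersection of members of a chain is comparable with every member of that chain, so
  a maximal chain contains it as soon as it is normal.
\<close>

lemma group_series_if_maximal:
  assumes norm: "\<forall>N\<in>T. N \<lhd> G" and ch: "chain\<^sub>\<subseteq> T"
    and max: "\<And>N. \<lbrakk>N \<lhd> G; \<forall>M\<in>T. M \<subseteq> N \<or> N \<subseteq> M\<rbrakk> \<Longrightarrow> N \<in> T"
  shows "group_series G T"
proof -
  have carr: "M \<subseteq> carrier G" "\<one> \<in> M" if "M \<in> T" for M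
    using norm that by (auto dest: normal_imp_subgroup subgroup.mem_carrier subgroup.one_closed)
  have "{\<one>} \<in> T" using carr by (intro max one_is_normal) auto
  moreover have "carrier G \<in> T"
    using carr by (intro max normal_invI subgroup_self) auto
  moreover have "\<Union>F \<in> T" "\<Inter>F \<in> T" if F: "F \<subseteq> T" "F \<noteq> {}" for F
  proof -
    have cmp: "M \<subseteq> N \<or> N \<subseteq> M" if "M \<in> T" "N \<in> F" for M N
      using that F ch by (auto simp: chain_subset_def)
    have "chain\<^sub>\<subseteq> F" using F ch by (auto simp: chain_subset_def)
    then have "\<Union>F \<lhd> G" using normal_Union_chain F norm by blast
    moreover have "\<Inter>F \<lhd> G" using normal_Inter F norm by blast
    moreover have "\<forall>M\<in>T. M \<subseteq> \<Union>F \<or> \<Union>F \<subseteq> M" "\<forall>M\<in>T. M \<subseteq> \<Inter>F \<or> \<Inter>F \<subseteq> M"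
      using cmp by (meson Sup_least Sup_upper2, meson Inf_greatest Inf_lower2)
    ultimately show "\<Union>F \<in> T" "\<Inter>F \<in> T" by (simp_all add: max)
  qed
  ultimately show ?thesis
    using norm ch by (simp add: group_series_def)
qed

end

text \<open>
  Every member of a chain lies below or above a given jump, so a normal subgroup inside the jump is
  comparable with all members and belongs to a maximal chain. The jumps of a maximal chain are
  thus chief factors.
\<close>

theorem theorem1:
  fixes G :: "('a, 'b) monoid_scheme"
  assumes "group G"
    and "\<And>h. h \<in> carrier G \<Longrightarrow> subgroup (unit_class G h) G"
  shows "Kurosh_Chernikov_Zbar G"
proof -
  interpret group G by (rule assms(1))
  have "\<exists>T. S \<subseteq> T \<and> central_series G T" if S: "group_series G S" for S
  proof -
    have "\<forall>N\<in>S. N \<lhd> G" "chain\<^sub>\<subseteq> S" using S by (auto simp: group_series_def)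
    then obtain T where ST: "S \<subseteq> T" and norm: "\<forall>N\<in>T. N \<lhd> G" and ch: "chain\<^sub>\<subseteq> T"
      and max: "\<And>N. \<lbrakk>N \<lhd> G; \<forall>M\<in>T. M \<subseteq> N \<or> N \<subseteq> M\<rbrakk> \<Longrightarrow> N \<in> T"
      by (rule normal_chain_extends_to_maximal) blast
    have "commutator_subgroup G B (carrier G) \<subseteq> A" if jump: "series_jump T A B" for A B
    proof (rule chief_factor_central[OF assms(2)])
      have AB: "A \<in> T" "B \<in> T" "A \<subset> B" and none: "\<And>C. C \<in> T \<Longrightarrow> \<not> (A \<subset> C \<and> C \<subset> B)"
        using jump by (auto simp: series_jump_def)
      show "A \<lhd> G" "B \<lhd> G" "A \<subseteq> B" using AB norm by auto
      fix N assume N: "N \<lhd> G" "A \<subseteq> N" "N \<subseteq> B"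
      have "M \<subseteq> A \<or> B \<subseteq> M" if "M \<in> T" for M
        using that AB ch none[OF that] unfolding chain_subset_def by blast
      then have "N \<in> T" using N by (intro max) blast+
      then show "N = A \<or> N = B" using N none by blast
    qed
    moreover have "group_series G T"
      by (rule group_series_if_maximal[OF norm ch max])
    ultimately show ?thesis using ST by (auto simp: central_series_def)
  qed
  then show ?thesis
    using assms(1) by (simp add: Kurosh_Chernikov_Zbar_def)
qed

end
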